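(* The undirected Engel graph of a finite group does not determine its Engel digraph up to isomorphism: there exist finite groups $G$ and $H$ such that the Engel graphs of $G$ and $H$ are isomorphic as undirected graphs but the Engel digraphs of $G$ and $H$ are not isomorphic as directed graphs.
   Context: For elements $x,y$ of a group, $[x,y]=x^{-1}y^{-1}xy$, $[x,{}_1y]=[x,y]$ and $[x,{}_{k+1}y]=[[x,{}_ky],y]$ for $k\ge 1$. The Engel digraph of a finite group $G$ has vertex set $G$ and, for distinct $x,y$, an arc $x\to y$ if there exists $k\geq 1$ such that $[y,{}_kx]=1$. The Engel graph is the simple undirected graph on $G$ in which distinct $x,y$ are adjacent iff there is an arc between them in at least one direction in the Engel digraph. *)

theory Defs
  imports
    "HOL-Algebra.Group"
    "Graph_Theory.Pair_Digraph"
    "Graph_Theory.Digraph_Component"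
    "Graph_Theory.Digraph_Isomorphism"
begin

(* The convention is [x,y] = x^-1 y^-1 x y; HOL-Algebra's derived_set uses x y x^-1 y^-1. *)
definition group_commutator :: "('a, 'b) monoid_scheme \<Rightarrow> 'a \<Rightarrow> 'a \<Rightarrow> 'a" where
  "group_commutator G x y = inv\<^bsub>G\<^esub> x \<otimes>\<^bsub>G\<^esub> inv\<^bsub>G\<^esub> y \<otimes>\<^bsub>G\<^esub> x \<otimes>\<^bsub>G\<^esub> y"

(* engel_commutator G x k y is [x,_k y] for k >= 1; the value x at k = 0 only starts the
   recursion, so that k = 1 gives [x,y]. *)
primrec engel_commutator :: "('a, 'b) monoid_scheme \<Rightarrow> 'a \<Rightarrow> nat \<Rightarrow> 'a \<Rightarrow> 'a" where
  "engel_commutator G x 0 y = x"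
| "engel_commutator G x (Suc k) y = group_commutator G (engel_commutator G x k y) y"

definition engel_digraph :: "('a, 'b) monoid_scheme \<Rightarrow> 'a pair_pre_digraph" where
  "engel_digraph G =
    \<lparr> pverts = carrier G,
      parcs = {(x, y). x \<in> carrier G \<and> y \<in> carrier G \<and> x \<noteq> y \<and>
                 (\<exists>k\<ge>1. engel_commutator G y k x = \<one>\<^bsub>G\<^esub>)} \<rparr>"

(* As in Graph_Theory, a simple undirected graph is a symmetric loop-free digraph, an edge
   {x,y} being the pair of arcs (x,y), (y,x). *)
definition engel_graph :: "('a, 'b) monoid_scheme \<Rightarrow> 'a pair_pre_digraph" where
  "engel_graph G =
    \<lparr> pverts = carrier G,
      parcs = {(x, y). x \<in> carrier G \<and> y \<in> carrier G \<and> x \<noteq> y \<and>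
                 ((x, y) \<in> parcs (engel_digraph G) \<or> (y, x) \<in> parcs (engel_digraph G))} \<rparr>"

lemma pair_digraph_engel_digraph:
  assumes "finite (carrier G)"
  shows "pair_digraph (engel_digraph G)"
proof -
  have "parcs (engel_digraph G) \<subseteq> carrier G \<times> carrier G"
    by (auto simp: engel_digraph_def)
  then have "finite (parcs (engel_digraph G))"
    using assms by (meson finite_SigmaI finite_subset)
  then show ?thesis
    using assms by unfold_locales (auto simp: engel_digraph_def)
qed

lemma engel_graph_eq_mk_symmetric:
  "engel_graph G = mk_symmetric (with_proj (engel_digraph G))"
  by (auto simp: engel_graph_def mk_symmetric_def engel_digraph_def)

lemma pair_graph_engel_graph:
  assumes "finite (carrier G)"
  shows "pair_graph (engel_graph G)"
proof -
  have "parcs (engel_graph G) \<subseteq> carrier G \<times> carrier G"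
    by (auto simp: engel_graph_def)
  then have "finite (parcs (engel_graph G))"
    using assms by (meson finite_SigmaI finite_subset)
  then show ?thesis
    using assms by unfold_locales (auto simp: engel_graph_def symmetric_def sym_def)
qed

end

theory Submission
  imports Defs "HOL-Algebra.Weak_Morphisms" "HOL-Library.Numeral_Type"
begin

(* For fixed e, the maps v \<mapsto> s v' + (a, b) with v = (u, w), v' = (u + e c w, w), c in F_3 and
   s = 1, -1 give an action on F_3^2 of the group G_e of all (a, b, c, s), which has order 54.  An
   element with s = 1 lies in the Fitting subgroup and hence has arcs to all other vertices.  An
   element x with s = -1 has exactly one fixed point p in F_3^2, with abelian stabilizer, and [y,x]
   fixes p iff y does; hence x \<rightarrow> y iff y fixes p.  Two elements with s = -1 are therefore
   adjacent iff their fixed points agree, so that the Engel graph does not depend on e.  But the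
   vertices to which all other vertices have an arc are the elements that act trivially on F_3^2:
   there are three of them in G_0 and one in G_1.  The same works for any commutative ring with
   1/2 (written h below) in place of F_3. *)

section \<open>Isomorphisms of Engel digraphs\<close>

text \<open>\<open>digraph_iso\<close> carries separate maps for vertices, arcs, tails and heads. An
  arc of a pair digraph is the pair of its ends, so the vertex map determines the rest.\<close>

lemma digraph_iso_with_proj_iff:
  assumes P: "pair_wf_digraph P" and Q: "pair_wf_digraph Q"
  shows "digraph_iso (with_proj P) (with_proj Q) \<longleftrightarrow>
    (\<exists>f. bij_betw f (pverts P) (pverts Q) \<and>
      (\<forall>x\<in>pverts P. \<forall>y\<in>pverts P. (x, y) \<in> parcs P \<longleftrightarrow> (f x, f y) \<in> parcs Q))"
    (is "_ \<longleftrightarrow> (\<exists>f. ?iso f)")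
proof
  assume "digraph_iso (with_proj P) (with_proj Q)"
  then obtain h where h: "pre_digraph.digraph_isomorphism (with_proj P) h"
    and Qh: "with_proj Q = app_iso h (with_proj P)"
    by (auto simp: digraph_iso_def)
  have inj: "inj_on (iso_verts h) (pverts P)"
    and ends: "\<And>a. a \<in> parcs P \<Longrightarrow> iso_verts h (fst a) = iso_tail h (iso_arcs h a) \<and>
      iso_verts h (snd a) = iso_head h (iso_arcs h a)"
    using h by (auto simp: pre_digraph.digraph_isomorphism_def)
  have verts: "pverts Q = iso_verts h ` pverts P" and arcs: "parcs Q = iso_arcs h ` parcs P"
    and th: "iso_tail h = fst" "iso_head h = snd"
    using Qh by (auto simp: with_proj_def app_iso_def)
  have arc: "iso_arcs h a = (iso_verts h (fst a), iso_verts h (snd a))" if "a \<in> parcs P" for a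
    using ends[OF that] th by (simp add: prod_eq_iff)
  have "(x, y) \<in> parcs P \<longleftrightarrow> (iso_verts h x, iso_verts h y) \<in> parcs Q"
    if xy: "x \<in> pverts P" "y \<in> pverts P" for x y
  proof
    assume "(x, y) \<in> parcs P"
    then show "(iso_verts h x, iso_verts h y) \<in> parcs Q"
      using arc arcs by (metis fst_conv image_eqI snd_conv)
  next
    assume "(iso_verts h x, iso_verts h y) \<in> parcs Q"
    then obtain a where a: "a \<in> parcs P" "(iso_verts h x, iso_verts h y) = iso_arcs h a"
      using arcs by auto
    have "fst a \<in> pverts P" "snd a \<in> pverts P"
      using pair_wf_digraph.arc_fst_in_verts[OF P a(1)] pair_wf_digraph.arc_snd_in_verts[OF P a(1)]
      by auto
    then have "fst a = x" "snd a = y"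
      using a arc[OF a(1)] xy inj by (auto dest: inj_onD)
    then show "(x, y) \<in> parcs P"
      using a(1) by auto
  qed
  then show "\<exists>f. ?iso f"
    using inj verts by (auto simp: bij_betw_def)
next
  assume "\<exists>f. ?iso f"
  then obtain f where bij: "bij_betw f (pverts P) (pverts Q)"
    and arc: "\<And>x y. x \<in> pverts P \<Longrightarrow> y \<in> pverts P \<Longrightarrow> (x, y) \<in> parcs P \<longleftrightarrow> (f x, f y) \<in> parcs Q"
    by blast
  define h where "h = \<lparr>iso_verts = f, iso_arcs = map_prod f f, iso_head = snd, iso_tail = fst\<rparr>"
  have sub: "parcs P \<subseteq> pverts P \<times> pverts P" "parcs Q \<subseteq> pverts Q \<times> pverts Q"
    using P Q by (auto simp: pair_wf_digraph_def)
  have inj: "inj_on f (pverts P)" and img: "f ` pverts P = pverts Q"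
    using bij by (auto simp: bij_betw_def)
  have "inj_on (map_prod f f) (parcs P)"
    using map_prod_inj_on[OF inj inj] sub(1) inj_on_subset by blast
  moreover have "wf_digraph (with_proj P)"
    using P by (rule wf_digraph_wp_iff[THEN iffD2])
  ultimately have "pre_digraph.digraph_isomorphism (with_proj P) h"
    using inj by (auto simp: h_def pre_digraph.digraph_isomorphism_def)
  moreover have "map_prod f f ` parcs P = parcs Q"
  proof (intro subset_antisym subsetI)
    fix a assume "a \<in> map_prod f f ` parcs P"
    then show "a \<in> parcs Q" using arc sub by auto
  next
    fix a assume a: "a \<in> parcs Q"
    moreover from a have "a \<in> f ` pverts P \<times> f ` pverts P"
      using sub(2) img by auto
    then obtain x y where xy: "x \<in> pverts P" "y \<in> pverts P" "a = (f x, f y)"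
      by auto
    ultimately have "(x, y) \<in> parcs P"
      using arc by simp
    then show "a \<in> map_prod f f ` parcs P"
      using xy(3) by (intro image_eqI[of _ _ "(x, y)"]) simp_all
  qed
  then have "with_proj Q = app_iso h (with_proj P)"
    using img by (simp add: with_proj_def app_iso_def h_def)
  ultimately show "digraph_iso (with_proj P) (with_proj Q)"
    by (auto simp: digraph_iso_def)
qed

lemma pair_wf_engel_digraph: "pair_wf_digraph (engel_digraph G)"
  by unfold_locales (auto simp: engel_digraph_def)

lemma pair_wf_engel_graph: "pair_wf_digraph (engel_graph G)"
  by unfold_locales (auto simp: engel_graph_def)

lemma pverts_engel_digraph [simp]: "pverts (engel_digraph G) = carrier G"
  by (simp add: engel_digraph_def)

lemma pverts_engel_graph [simp]: "pverts (engel_graph G) = carrier G"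
  by (simp add: engel_graph_def)

section \<open>Transport along group isomorphisms\<close>

lemma engel_commutator_closed:
  assumes "group G" "x \<in> carrier G" "y \<in> carrier G"
  shows "engel_commutator G x k y \<in> carrier G"
proof -
  interpret group G by fact
  show ?thesis using assms by (induction k) (auto simp: group_commutator_def)
qed

lemma engel_commutator_hom:
  assumes "group_hom G H f" "x \<in> carrier G" "y \<in> carrier G"
  shows "engel_commutator H (f x) k (f y) = f (engel_commutator G x k y)"
proof -
  interpret group_hom G H f by fact
  show ?thesis
    using assms(2,3) engel_commutator_closed[OF G.is_group assms(2,3)]
    by (induction k) (auto simp: group_commutator_def)
qed

lemma engel_digraph_arc_iso:
  assumes "group G" "group H" "f \<in> iso G H" "x \<in> carrier G" "y \<in> carrier G"
  shows "(f x, f y) \<in> parcs (engel_digraph H) \<longleftrightarrow> (x, y) \<in> parcs (engel_digraph G)"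
proof -
  interpret G: group G by fact
  interpret H: group H by fact
  have hom: "group_hom G H f"
    using assms by unfold_locales (simp add: iso_def)
  interpret group_hom G H f by fact
  have inj: "inj_on f (carrier G)"
    using assms by (auto simp: iso_def bij_betw_def)
  have "f z = \<one>\<^bsub>H\<^esub> \<longleftrightarrow> z = \<one>\<^bsub>G\<^esub>" if "z \<in> carrier G" for z
    using inj that by (metis G.one_closed hom_one inj_onD)
  moreover have "f x = f y \<longleftrightarrow> x = y"
    using inj assms by (auto dest: inj_onD)
  ultimately show ?thesis
    using assms by (simp add: engel_digraph_def engel_commutator_hom[OF hom]
        engel_commutator_closed)
qed

lemma digraph_iso_engel_digraph:
  assumes "group G" "group H" "f \<in> iso G H"
  shows "digraph_iso (with_proj (engel_digraph G)) (with_proj (engel_digraph H))"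
proof -
  have "bij_betw f (carrier G) (carrier H)"
    using assms by (simp add: iso_def)
  then show ?thesis
    using engel_digraph_arc_iso[OF assms]
    unfolding digraph_iso_with_proj_iff[OF pair_wf_engel_digraph pair_wf_engel_digraph]
    by (intro exI[of _ f]) simp
qed

lemma digraph_iso_engel_graph:
  assumes "group G" "group H" "f \<in> iso G H"
  shows "digraph_iso (with_proj (engel_graph G)) (with_proj (engel_graph H))"
proof -
  have bij: "bij_betw f (carrier G) (carrier H)"
    using assms by (simp add: iso_def)
  then have "f x \<in> carrier H" "f x = f y \<longleftrightarrow> x = y" if "x \<in> carrier G" "y \<in> carrier G" for x y
    using that by (auto simp: bij_betw_def dest: inj_onD)
  then show ?thesis
    using bij engel_digraph_arc_iso[OF assms]
    unfolding digraph_iso_with_proj_iff[OF pair_wf_engel_graph pair_wf_engel_graph]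
    by (intro exI[of _ f]) (simp add: engel_graph_def)
qed

text \<open>The groups constructed below consist of quadruples over a ring; this moves them to
  carriers in \<open>nat\<close>, where the final theorem is stated.\<close>

lemma finite_group_nat_copy:
  assumes "group G" "finite (carrier G)"
  obtains N :: "nat monoid" and f where "group N" "finite (carrier N)" "f \<in> iso G N"
proof -
  obtain f :: "_ \<Rightarrow> nat" where "inj_on f (carrier G)"
    using finite_imp_inj_to_nat_seg[OF assms(2)] by blast
  then have "f \<in> iso G (image_group f G)" "group (image_group f G)"
    using assms(1) by (auto intro: inj_imp_image_group_iso group.inj_imp_image_group_is_group)
  moreover have "finite (carrier (image_group f G))"
    using assms(2) by (simp add: image_group_def)
  ultimately show thesis
    using that by blast
qed

section \<open>The groups \<open>G\<^sub>e\<close>\<close>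

type_synonym 'a quad = "'a \<times> 'a \<times> 'a \<times> 'a"

text \<open>The product composes the maps of \<open>act\<close> and adds the \<open>c\<close>.
  Keeping \<open>c\<close> as a coordinate gives the same carrier for all \<open>e\<close>, even for
  \<open>e = 0\<close>, where \<open>c\<close> acts trivially. The elements with
  \<open>s = 1\<close> form the Heisenberg group over the ring if \<open>e = 1\<close> and an
  abelian group if \<open>e = 0\<close>.\<close>

definition affine_group :: "'a::comm_ring_1 \<Rightarrow> 'a quad monoid" where
  "affine_group e =
    \<lparr> carrier = {(a, b, c, s). s = 1 \<or> s = -1},
      monoid.mult = (\<lambda>(a, b, c, s) (a', b', c', s').
        (a + s * (a' + e * c * b'), b + s * b', c + c', s * s')),
      one = (0, 0, 0, 1) \<rparr>"

fun act :: "'a::comm_ring_1 \<Rightarrow> 'a quad \<Rightarrow> 'a \<times> 'a \<Rightarrow> 'a \<times> 'a" where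
  "act e (a, b, c, s) (u, w) = (a + s * (u + e * c * w), b + s * w)"

lemma carrier_affine_group: "(a, b, c, s) \<in> carrier (affine_group e) \<longleftrightarrow> s = 1 \<or> s = -1"
  by (simp add: affine_group_def)

lemma mult_affine_group:
  "(a, b, c, s) \<otimes>\<^bsub>affine_group e\<^esub> (a', b', c', s') =
    (a + s * (a' + e * c * b'), b + s * b', c + c', s * s')"
  by (simp add: affine_group_def)

lemma one_affine_group: "\<one>\<^bsub>affine_group e\<^esub> = (0, 0, 0, 1)"
  by (simp add: affine_group_def)

lemmas affine_group_simps = carrier_affine_group mult_affine_group one_affine_group

lemma group_affine_group: "group (affine_group e)"
proof (rule groupI)
  fix x assume "x \<in> carrier (affine_group e)"
  moreover obtain a b c s where "x = (a, b, c, s)" by (cases x)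
  \<comment> \<open>The witness comes from solving \<open>y x = 1\<close> coordinate by coordinate,
    with \<open>s * s = 1\<close>.\<close>
  ultimately show "\<exists>y\<in>carrier (affine_group e). y \<otimes>\<^bsub>affine_group e\<^esub> x = \<one>\<^bsub>affine_group e\<^esub>"
    by (intro bexI[of _ "(s * (e * c * b - a), - s * b, - c, s)"])
      (auto simp: affine_group_simps algebra_simps)
qed (auto simp: affine_group_simps algebra_simps split: prod.splits)

lemma inv_affine_group:
  assumes "(a, b, c, s) \<in> carrier (affine_group e)"
  shows "inv\<^bsub>affine_group e\<^esub> (a, b, c, s) = (s * (e * c * b - a), - s * b, - c, s)"
proof (rule group.inv_equality[OF group_affine_group])
qed (use assms in \<open>auto simp: affine_group_simps algebra_simps\<close>)

lemma act_mult: "act e (x \<otimes>\<^bsub>affine_group e\<^esub> y) p = act e x (act e y p)"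
  by (cases x; cases y; cases p) (simp add: mult_affine_group algebra_simps)

lemma act_one: "act e \<one>\<^bsub>affine_group e\<^esub> p = p"
  by (cases p) (simp add: one_affine_group)

lemma act_inv_eq_iff:
  assumes "x \<in> carrier (affine_group e)"
  shows "act e (inv\<^bsub>affine_group e\<^esub> x) p = q \<longleftrightarrow> p = act e x q"
  using assms group.l_inv[OF group_affine_group assms] group.r_inv[OF group_affine_group assms]
  by (metis act_mult act_one)

text \<open>The coordinates \<open>c\<close> and \<open>s\<close> are homomorphisms into commutative
  groups, hence trivial on commutators.\<close>

lemma commutator_affine_group:
  assumes "x \<in> carrier (affine_group e)" "y \<in> carrier (affine_group e)"
  shows "\<exists>a b. group_commutator (affine_group e) x y = (a, b, 0, 1)"
  using assms by (cases x; cases y)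
    (auto simp: group_commutator_def inv_affine_group affine_group_simps)

text \<open>The first commutator lies in the subgroup \<open>s = 1\<close>. That subgroup is
  nilpotent of class at most 2, so two more commutators with one of its elements reach the
  identity.\<close>

lemma engel_commutator_translation:
  assumes "x \<in> carrier (affine_group e)" "(a, b, c, 1) \<in> carrier (affine_group e)"
  shows "engel_commutator (affine_group e) x 3 (a, b, c, 1) = \<one>\<^bsub>affine_group e\<^esub>"
proof -
  obtain p q where pq: "group_commutator (affine_group e) x (a, b, c, 1) = (p, q, 0, 1)"
    using commutator_affine_group[OF assms] by blast
  show ?thesis
    by (simp add: numeral_3_eq_3 pq)
      (simp add: group_commutator_def inv_affine_group affine_group_simps algebra_simps)
qed

section \<open>Fixed points\<close>

text \<open>A fixed point \<open>(u, w)\<close> of an element with \<open>s = -1\<close> satisfies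
  \<open>2 w = b\<close> and \<open>2 u = a - e c w\<close>; the formula solves these equations,
  with \<open>h\<close> for 1/2. Only for \<open>s = -1\<close> does the value have this
  meaning.\<close>

fun fixpt :: "'a::comm_ring_1 \<Rightarrow> 'a \<Rightarrow> 'a quad \<Rightarrow> 'a \<times> 'a" where
  "fixpt h e (a, b, c, s) = (h * (a - e * c * h * b), h * b)"

lemma act_eq_iff_fixpt:
  assumes "2 * h = (1::'a::comm_ring_1)"
  shows "act e (a, b, c, - 1) p = p \<longleftrightarrow> p = fixpt h e (a, b, c, - 1)"
proof -
  have half: "x = h * y \<longleftrightarrow> y = x + x" for x y :: 'a
  proof
    assume "x = h * y"
    then have "x + x = (2 * h) * y" by (simp add: algebra_simps)
    then show "y = x + x" using assms by simp
  next
    assume "y = x + x"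
    then have "h * y = (2 * h) * x" by (simp add: algebra_simps)
    then show "x = h * y" using assms by simp
  qed
  obtain u w where p: "p = (u, w)" by (cases p)
  have "act e (a, b, c, - 1) p = p \<longleftrightarrow> a - e * c * w = u + u \<and> b = w + w"
    unfolding p by (auto simp: algebra_simps)
  also have "\<dots> \<longleftrightarrow> u = h * (a - e * c * w) \<and> w = h * b"
    by (simp add: half)
  also have "\<dots> \<longleftrightarrow> p = fixpt h e (a, b, c, - 1)"
    unfolding p by (auto simp: algebra_simps)
  finally show ?thesis .
qed

text \<open>Let \<open>p\<close> be the fixed point of \<open>x\<close>. Then
  \<open>[y,x] = y^-1 x^-1 y x\<close> fixes \<open>p\<close> iff \<open>x\<close> fixes
  \<open>y p\<close>, and by uniqueness of the fixed point this means
  \<open>y p = p\<close>.\<close>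

lemma act_commutator_fixpt_iff:
  assumes half: "2 * h = (1::'a::comm_ring_1)"
    and x: "x = (a, b, c, - 1)" and y: "y \<in> carrier (affine_group e)"
  shows "act e (group_commutator (affine_group e) y x) (fixpt h e x) = fixpt h e x \<longleftrightarrow>
    act e y (fixpt h e x) = fixpt h e x"
proof -
  let ?p = "fixpt h e x"
  have xG: "x \<in> carrier (affine_group e)"
    by (simp add: x carrier_affine_group)
  have fix_iff: "act e x q = q \<longleftrightarrow> q = ?p" for q
    using act_eq_iff_fixpt[OF half] x by blast
  have "act e (group_commutator (affine_group e) y x) ?p = ?p \<longleftrightarrow> act e y ?p = act e x (act e y ?p)"
    using xG y fix_iff[of ?p] by (simp add: group_commutator_def act_mult act_inv_eq_iff)
  then show ?thesis
    using fix_iff[of "act e y ?p"] by metis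
qed

lemma engel_iff_fixpt:
  assumes half: "2 * h = (1::'a::comm_ring_1)"
    and x: "x = (a, b, c, - 1)" and y: "y \<in> carrier (affine_group e)"
  shows "(\<exists>k\<ge>1. engel_commutator (affine_group e) y k x = \<one>\<^bsub>affine_group e\<^esub>) \<longleftrightarrow>
    act e y (fixpt h e x) = fixpt h e x" (is "?L \<longleftrightarrow> ?R")
proof
  have xG: "x \<in> carrier (affine_group e)"
    by (simp add: x carrier_affine_group)
  \<comment> \<open>The case \<open>k = 0\<close> is \<open>y\<close> itself, and each further
    commutator preserves the equivalence. The identity fixes every point, so reaching it forces
    \<open>?R\<close>.\<close>
  have "act e (engel_commutator (affine_group e) y k x) (fixpt h e x) = fixpt h e x \<longleftrightarrow> ?R" for k
    by (induction k)
      (simp_all add: act_commutator_fixpt_iff[OF half x]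
        engel_commutator_closed[OF group_affine_group y xG])
  then show ?R if ?L
    using that by (metis act_one)
next
  assume ?R
  have xG: "x \<in> carrier (affine_group e)"
    by (simp add: x carrier_affine_group)
  obtain p q where pq: "group_commutator (affine_group e) y x = (p, q, 0, 1)"
    using commutator_affine_group[OF y xG] by blast
  obtain u w where uw: "fixpt h e x = (u, w)" by (cases "fixpt h e x")
  \<comment> \<open>The commutator acts as the translation by \<open>(p, q)\<close>. A translation
    with a fixed point is zero, so \<open>k = 1\<close> already suffices.\<close>
  have "act e (p, q, 0, 1) (u, w) = (u, w)"
    using \<open>?R\<close> act_commutator_fixpt_iff[OF half x y] pq uw by simp
  then have "engel_commutator (affine_group e) y 1 x = \<one>\<^bsub>affine_group e\<^esub>"
    by (simp add: pq one_affine_group)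
  then show ?L by blast
qed

lemma engel_digraph_affine_group_arc_iff:
  assumes half: "2 * h = (1::'a::comm_ring_1)"
    and x: "x = (a, b, c, s)" "x \<in> carrier (affine_group e)" and y: "y \<in> carrier (affine_group e)"
  shows "(x, y) \<in> parcs (engel_digraph (affine_group e)) \<longleftrightarrow>
    x \<noteq> y \<and> (s = - 1 \<longrightarrow> act e y (fixpt h e x) = fixpt h e x)"
proof (cases "s = - 1")
  case True
  then show ?thesis
    using engel_iff_fixpt[OF half _ y] x y by (simp add: engel_digraph_def)
next
  case False
  then have "engel_commutator (affine_group e) y 3 x = \<one>\<^bsub>affine_group e\<^esub>"
    using engel_commutator_translation[OF y] x by (simp add: carrier_affine_group)
  then have "\<exists>k\<ge>1. engel_commutator (affine_group e) y k x = \<one>\<^bsub>affine_group e\<^esub>"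
    by (intro exI[of _ 3]) simp
  then show ?thesis
    using False x y by (simp add: engel_digraph_def)
qed

text \<open>An element with \<open>s = 1\<close> has arcs to all others, so only two elements with
  \<open>s = -1\<close> can fail to be adjacent. Each of them has just one fixed point, so one fixes
  the fixed point of the other iff the two points agree.\<close>

lemma engel_graph_affine_group_arc_iff:
  assumes half: "2 * h = (1::'a::comm_ring_1)"
    and x: "x = (a, b, c, s)" "x \<in> carrier (affine_group e)"
    and y: "y = (a', b', c', s')" "y \<in> carrier (affine_group e)"
  shows "(x, y) \<in> parcs (engel_graph (affine_group e)) \<longleftrightarrow>
    x \<noteq> y \<and> (s = - 1 \<and> s' = - 1 \<longrightarrow> fixpt h e x = fixpt h e y)"
proof -
  have "act e y (fixpt h e x) = fixpt h e x \<longleftrightarrow> fixpt h e x = fixpt h e y" if "s' = - 1"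
    using act_eq_iff_fixpt[OF half] y that by blast
  moreover have "act e x (fixpt h e y) = fixpt h e y \<longleftrightarrow> fixpt h e x = fixpt h e y" if "s = - 1"
    using act_eq_iff_fixpt[OF half] x that by metis
  ultimately show ?thesis
    using engel_digraph_affine_group_arc_iff[OF half x y(2)]
      engel_digraph_affine_group_arc_iff[OF half y x(2)] x(2) y(2)
    unfolding engel_graph_def by auto
qed

lemma engel_graph_affine_group_iso:
  assumes half: "2 * h = (1::'a::comm_ring_1)"
  shows "digraph_iso (with_proj (engel_graph (affine_group (0::'a))))
    (with_proj (engel_graph (affine_group (e::'a))))"
proof -
  \<comment> \<open>The shift of \<open>a\<close> cancels the term with \<open>e\<close> in
    \<open>fixpt\<close>, so that \<open>f\<close> preserves fixed points as well as
    \<open>s\<close>.\<close>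
  define f :: "'a quad \<Rightarrow> 'a quad" where "f = (\<lambda>(a, b, c, s). (a + e * c * h * b, b, c, s))"
  have bij: "bij_betw f (carrier (affine_group 0)) (carrier (affine_group e))"
    by (rule bij_betw_byWitness[where f' = "\<lambda>(a, b, c, s). (a - e * c * h * b, b, c, s)"])
      (auto simp: f_def affine_group_def)
  have "(x, y) \<in> parcs (engel_graph (affine_group 0)) \<longleftrightarrow>
      (f x, f y) \<in> parcs (engel_graph (affine_group e))"
    if xy: "x \<in> carrier (affine_group 0)" "y \<in> carrier (affine_group 0)" for x y
  proof -
    obtain a b c s a' b' c' s' where e: "x = (a, b, c, s)" "y = (a', b', c', s')"
      by (cases x; cases y)
    have fe: "f x = (a + e * c * h * b, b, c, s)" "f y = (a' + e * c' * h * b', b', c', s')"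
      by (auto simp: e f_def)
    have fG: "f x \<in> carrier (affine_group e)" "f y \<in> carrier (affine_group e)"
      using bij xy by (auto simp: bij_betw_def)
    have "f x = f y \<longleftrightarrow> x = y"
      using bij xy by (auto simp: bij_betw_def dest: inj_onD)
    moreover have "fixpt h e (f x) = fixpt h 0 x" "fixpt h e (f y) = fixpt h 0 y"
      by (simp_all add: e f_def)
    ultimately show ?thesis
      using engel_graph_affine_group_arc_iff[OF half e(1) xy(1) e(2) xy(2)]
        engel_graph_affine_group_arc_iff[OF half fe(1) fG(1) fe(2) fG(2)] by simp
  qed
  then show ?thesis
    using bij unfolding digraph_iso_with_proj_iff[OF pair_wf_engel_graph pair_wf_engel_graph]
    by (intro exI[of _ f]) simp
qed

section \<open>Vertices dominated by all others\<close>

text \<open>For \<open>e = 0\<close> the element \<open>(0, 0, c, 1)\<close> acts trivially, so it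
  fixes the fixed point of every \<open>x\<close>.\<close>

lemma affine_group_0_dominated:
  assumes half: "2 * h = (1::'a::comm_ring_1)"
    and "x \<in> carrier (affine_group 0)" "x \<noteq> (0, 0, c, 1)"
  shows "(x, (0, 0, c, 1)) \<in> parcs (engel_digraph (affine_group (0::'a)))"
proof -
  obtain a b c' s where "x = (a, b, c', s)" by (cases x)
  then show ?thesis
    using assms(2,3) by (simp add: engel_digraph_affine_group_arc_iff[OF half] carrier_affine_group)
qed

text \<open>Every point \<open>(u, w)\<close> is the fixed point of the reflection
  \<open>(2 u, 2 w, 0, -1)\<close>, so \<open>y\<close> fixes all points. For \<open>e = 1\<close>
  the action is faithful.\<close>

lemma affine_group_1_dominated:
  assumes half: "2 * h = (1::'a::comm_ring_1)" and y: "y \<in> carrier (affine_group (1::'a))"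
    and dom: "\<And>x. x \<in> carrier (affine_group 1) \<Longrightarrow> x \<noteq> y \<Longrightarrow>
      (x, y) \<in> parcs (engel_digraph (affine_group 1))"
  shows "y = (0, 0, 0, 1)"
proof -
  have trivial: "act 1 y (u, w) = (u, w)" for u w
  \<comment> \<open>If \<open>y\<close> is this reflection itself, \<open>dom\<close> says nothing
    about the pair, but \<open>y\<close> fixes its own centre.\<close>
  proof (cases "y = (2 * u, 2 * w, 0, - 1)")
    case True
    then show ?thesis by (simp add: algebra_simps)
  next
    case False
    let ?x = "(2 * u, 2 * w, 0, - 1)"
    have "?x \<in> carrier (affine_group 1)"
      by (simp add: carrier_affine_group)
    then have "act 1 y (fixpt h 1 ?x) = fixpt h 1 ?x"
      using dom False y by (metis engel_digraph_affine_group_arc_iff[OF half refl])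
    moreover have "h * (2 * z) = z" for z
      using half by (simp add: mult.assoc[symmetric] mult.commute[of h])
    ultimately show ?thesis by simp
  qed
  obtain a b c s where y_eq: "y = (a, b, c, s)" by (cases y)
  \<comment> \<open>The origin detects the translation part; the point \<open>(0, 1)\<close> then
    gives \<open>s\<close> in its second coordinate and \<open>c\<close> in its first.\<close>
  have "a = 0" "b = 0"
    using trivial[of 0 0] by (simp_all add: y_eq)
  moreover from this have "s = 1"
    using trivial[of 0 1] by (simp add: y_eq)
  moreover from calculation have "c = 0"
    using trivial[of 0 1] by (simp add: y_eq)
  ultimately show ?thesis by (simp add: y_eq)
qed

lemma engel_digraph_affine_group_not_iso:
  assumes half: "2 * h = (1::'a::comm_ring_1)"
  shows "\<not> digraph_iso (with_proj (engel_digraph (affine_group (0::'a))))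
    (with_proj (engel_digraph (affine_group (1::'a))))"
proof
  let ?G = "affine_group (0::'a)" and ?H = "affine_group (1::'a)"
  assume "digraph_iso (with_proj (engel_digraph ?G)) (with_proj (engel_digraph ?H))"
  then obtain f where bij: "bij_betw f (carrier ?G) (carrier ?H)"
    and arc: "\<And>x y. x \<in> carrier ?G \<Longrightarrow> y \<in> carrier ?G \<Longrightarrow>
      (x, y) \<in> parcs (engel_digraph ?G) \<longleftrightarrow> (f x, f y) \<in> parcs (engel_digraph ?H)"
    unfolding digraph_iso_with_proj_iff[OF pair_wf_engel_digraph pair_wf_engel_digraph]
    by auto
  have img: "f (0, 0, c, 1) = (0, 0, 0, 1)" for c
  proof (rule affine_group_1_dominated[OF half])
    have zG: "(0, 0, c, 1) \<in> carrier ?G"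
      by (simp add: carrier_affine_group)
    then show "f (0, 0, c, 1) \<in> carrier ?H"
      using bij by (auto simp: bij_betw_def)
    fix x assume x: "x \<in> carrier ?H" "x \<noteq> f (0, 0, c, 1)"
    have "x \<in> f ` carrier ?G"
      using x(1) bij by (simp add: bij_betw_imp_surj_on)
    then obtain x' where x': "x' \<in> carrier ?G" "x = f x'"
      by (rule imageE)
    then have "(x', (0, 0, c, 1)) \<in> parcs (engel_digraph ?G)"
      using x(2) by (intro affine_group_0_dominated[OF half]) auto
    then show "(x, f (0, 0, c, 1)) \<in> parcs (engel_digraph ?H)"
      unfolding x'(2) using arc[OF x'(1) zG] by simp
  qed
  \<comment> \<open>Two different values of \<open>c\<close> have the same image, against
    injectivity of \<open>f\<close>.\<close>
  have "((0, 0, 0, 1) :: 'a quad) = (0, 0, 1, 1)"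
  proof (rule inj_onD)
    show "inj_on f (carrier ?G)"
      using bij by (rule bij_betw_imp_inj_on)
  qed (simp_all add: img carrier_affine_group)
  then show False by simp
qed

(* Every finite group is isomorphic to one whose carrier is a set of natural numbers, so
   ranging over nat monoid ranges over all finite groups up to isomorphism. *)
theorem mainTheorem5:
  shows "\<exists>(G :: nat monoid) (H :: nat monoid).
           group G \<and> finite (carrier G) \<and> group H \<and> finite (carrier H) \<and>
           digraph_iso (with_proj (engel_graph G)) (with_proj (engel_graph H)) \<and>
           \<not> digraph_iso (with_proj (engel_digraph G)) (with_proj (engel_digraph H))"
proof -
  let ?G = "affine_group (0::3)" and ?H = "affine_group (1::3)"
  \<comment> \<open>In the integers modulo 3 the element 2 is its own inverse and serves as
    \<open>h\<close>.\<close>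
  have half: "2 * 2 = (1::3)" by simp
  obtain G :: "nat monoid" and g where G: "group G" "finite (carrier G)" "g \<in> iso ?G G"
    using finite_group_nat_copy[OF group_affine_group finite] .
  obtain H :: "nat monoid" and h where H: "group H" "finite (carrier H)" "h \<in> iso ?H H"
    using finite_group_nat_copy[OF group_affine_group finite] .
  note G_iso = group_affine_group G(1,3)
    and H_iso = group_affine_group H(1,3)
  have wf: "wf_digraph (with_proj (engel_graph K))" "wf_digraph (with_proj (engel_digraph K))"
    for K :: "('b, 'c) monoid_scheme"
    by (simp_all add: wf_digraph_wp_iff pair_wf_engel_graph pair_wf_engel_digraph)
  \<comment> \<open>The chain runs from \<open>G\<close> back to \<open>?G\<close>, across to
    \<open>?H\<close>, and on to \<open>H\<close>.\<close>
  have "digraph_iso (with_proj (engel_graph G)) (with_proj (engel_graph H))"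
    by (rule digraph_iso_trans[OF digraph_iso_swap[OF wf(1) digraph_iso_engel_graph[OF G_iso]]
          digraph_iso_trans[OF engel_graph_affine_group_iso[OF half]
            digraph_iso_engel_graph[OF H_iso]]])
  moreover have "\<not> digraph_iso (with_proj (engel_digraph G)) (with_proj (engel_digraph H))"
  proof
    assume "digraph_iso (with_proj (engel_digraph G)) (with_proj (engel_digraph H))"
    from digraph_iso_trans[OF digraph_iso_engel_digraph[OF G_iso] digraph_iso_trans[OF this
        digraph_iso_swap[OF wf(2) digraph_iso_engel_digraph[OF H_iso]]]]
    show False
      using engel_digraph_affine_group_not_iso[OF half] by blast
  qed
  ultimately show ?thesis
    using G(1,2) H(1,2) by (intro exI[of _ G] exI[of _ H] conjI)
qed

end
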